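(* Let $D$ be a two-input two-output signal flow graph whose first-order branches' open-loop poles $z_1,\dots,z_n$ are either indeterminates or constants, let $\Sigma(A,B,C)$ be its linear system, and let $T=C(sI-A)^{-1}B$ be its $2\times2$ transfer function matrix ($T(s,z)$ or $T(s)$). If $T$ is invertible, then there exists at least one general 2-path in $D$.
   Context: A standard signal flow graph (SFG) is a finite directed graph without parallel branches and without self-loops, whose branches are of two types: first-order branches $x_1,\dots,x_n$, the branch $x_i$ having gain $1/(s-z_i)$ ($z_i$ is called its open-loop pole) and being followed in series by a zero-order branch of gain $1$; and zero-order branches of gain $1$. Every node variable is the sum of the signals carried by the branches entering it; if $w$ is the variable of the input node of the first-order branch $x_i$, then its output (state variable) $x_i$ satisfies $\dot x_i=z_ix_i+w$. In the two-input two-output (TITO) case there are distinct input nodes $u_1,u_2$ of in-degree $0$ and distinct output nodes $y_1,y_2$ of out-degree $0$. Every node other than input and output nodes has in-degree at most $1$ or out-degree at most $1$. The corresponding linear system $\Sigma(A,B,C)$ is $\dot x=Ax+Bu$, $y=Cx$ with $x=[x_1,\dots,x_n]^T$, $u=[u_1,u_2]^T$, $y=[y_1,y_2]^T$, where $A$ has diagonal entries $z_1,\dots,z_n$, every off-diagonal entry of $A$ is $0$ or $1$, and all entries of $B$ and $C$ are $0$ or $1$. Invertibility is over the field of rational functions in $s$ with coefficients in $F(z)$ (the field of real rational functions in the indeterminates $z$) or in $\mathbb{R}$ (when the poles are real constants). A path is a directed walk passing through each of its nodes only once. A general 2-path is a pair of node-disjoint paths $P_1,P_2$ such that $P_i$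 goes from $u_{j_i}$ to $y_i$ ($i=1,2$), where $(j_1,j_2)$ is some permutation of $(1,2)$. *)

theory Defs
  imports
    "HOL-Analysis.Analysis"
    "HOL-Computational_Algebra.Polynomial_Factorial"
    "HOL-Library.Poly_Mapping"
    "Graph_Theory.Digraph"
    "Graph_Theory.Arc_Walk"
begin

section \<open>Standard two-input two-output signal flow graphs\<close>

text \<open>
  The branch \<open>x i\<close> is the first-order branch with state variable \<open>x\<^sub>i\<close>; all branches of \<open>D\<close>
  outside \<open>range x\<close> are zero-order branches of gain 1.  The index type \<open>'n\<close> stands for
  \<open>{1, \<dots>, n}\<close> and the type \<open>2\<close> for \<open>{1, 2}\<close>.  A connection in series means that the node between
  the two branches is incident with no other branch.
\<close>

locale tito_sfg = digraph D
  for D :: "('v, 'b) pre_digraph"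
  and x :: "'n::finite \<Rightarrow> 'b"
  and inp :: "2 \<Rightarrow> 'v"
  and outp :: "2 \<Rightarrow> 'v" +
  assumes first_order_arcs: "range x \<subseteq> arcs D"
    and first_order_inj: "inj x"
    and first_order_series: "in_arcs D (head D (x i)) = {x i}"
      "\<exists>e. e \<notin> range x \<and> out_arcs D (head D (x i)) = {e}"
    and inp_verts: "inp k \<in> verts D"
    and inp_inj: "inj inp"
    and inp_in_degree: "in_degree D (inp k) = 0"
    and outp_verts: "outp k \<in> verts D"
    and outp_inj: "inj outp"
    and outp_out_degree: "out_degree D (outp k) = 0"
    and inner_degree: "\<lbrakk>v \<in> verts D; v \<notin> range inp; v \<notin> range outp\<rbrakk>
      \<Longrightarrow> in_degree D v \<le> 1 \<or> out_degree D v \<le> 1"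

section \<open>The linear system of a signal flow graph\<close>

text \<open>
  \<open>\<xi>\<close> assigns to every node its node variable, given the values \<open>X\<close> of the state variables and \<open>U\<close>
  of the inputs.  A first-order branch carries its state variable, a zero-order branch carries the
  variable of its input node.
\<close>

definition node_equations ::
    "('v, 'b) pre_digraph \<Rightarrow> ('n::finite \<Rightarrow> 'b) \<Rightarrow> (2 \<Rightarrow> 'v) \<Rightarrow>
     'k::field ^ 'n \<Rightarrow> 'k ^ 2 \<Rightarrow> ('v \<Rightarrow> 'k) \<Rightarrow> bool" where
  "node_equations D x inp X U \<xi> \<longleftrightarrow>
     (\<forall>k. \<xi> (inp k) = U $ k) \<and>
     (\<forall>v \<in> verts D - range inp.
        \<xi> v = (\<Sum>i | x i \<in> in_arcs D v. X $ i) +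
              (\<Sum>e \<in> in_arcs D v - range x. \<xi> (tail D e)))"

text \<open>
  \<open>\<Sigma>(A,B,C)\<close> results from eliminating the node variables from
  \<open>dx\<^sub>i/dt = z\<^sub>i x\<^sub>i + w\<^sub>i\<close> and \<open>y\<^sub>k = \<xi> (outp k)\<close>, where \<open>w\<^sub>i\<close> is the variable of the input node of the
  branch \<open>x i\<close>.  The elimination presupposes that states and inputs determine the node variables
  (\<open>\<exists>!\<close> below; \<open>extensional\<close> only fixes the irrelevant values off the node set).  All these
  relations are algebraic at each instant and linear, so the values range over the field \<open>'k\<close> that
  contains the poles.
\<close>

definition linear_system ::
    "('v, 'b) pre_digraph \<Rightarrow> ('n::finite \<Rightarrow> 'b) \<Rightarrow> (2 \<Rightarrow> 'v) \<Rightarrow> (2 \<Rightarrow> 'v) \<Rightarrow> ('n \<Rightarrow> 'k::field) \<Rightarrow>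
     'k ^ 'n ^ 'n \<Rightarrow> 'k ^ 2 ^ 'n \<Rightarrow> 'k ^ 'n ^ 2 \<Rightarrow> bool" where
  "linear_system D x inp outp z A B C \<longleftrightarrow>
     (\<forall>(X :: 'k ^ 'n) (U :: 'k ^ 2).
        \<exists>!\<xi>. \<xi> \<in> extensional (verts D) \<and> node_equations D x inp X U \<xi>) \<and>
     (\<forall>(X :: 'k ^ 'n) (U :: 'k ^ 2) \<xi>. node_equations D x inp X U \<xi> \<longrightarrow>
        (\<forall>i. z i * X $ i + \<xi> (tail D (x i)) = (A *v X + B *v U) $ i) \<and>
        (\<forall>k. \<xi> (outp k) = (C *v X) $ k)) \<and>
     (\<forall>i. A $ i $ i = z i) \<and>
     (\<forall>i j. i \<noteq> j \<longrightarrow> A $ i $ j \<in> {0, 1}) \<and>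
     (\<forall>i k. B $ i $ k \<in> {0, 1}) \<and>
     (\<forall>k i. C $ k $ i \<in> {0, 1})"

text \<open>\<open>'k poly fract\<close> is the field of rational functions in \<open>s\<close> over \<open>'k\<close>; the variable \<open>s\<close> is
  \<open>to_fract [:0, 1:]\<close>.\<close>

definition rat_const :: "'k::field \<Rightarrow> 'k poly fract" where
  "rat_const c = to_fract [:c:]"

definition transfer_matrix ::
    "'k::field ^ 'n ^ 'n \<Rightarrow> 'k ^ 2 ^ 'n \<Rightarrow> 'k ^ 'n ^ 2 \<Rightarrow> ('k poly fract) ^ 2 ^ 2" where
  "transfer_matrix A B C =
     map_matrix rat_const C **
     matrix_inv (mat (to_fract [:0, 1:]) - map_matrix rat_const A) **
     map_matrix rat_const B"

section \<open>Indeterminate poles\<close>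

text \<open>
  The field of real rational functions in indeterminates indexed by \<open>'n\<close>; a monomial is a finitely
  supported map from indeterminates to exponents.
\<close>

type_synonym 'n rat_functions = "(('n \<Rightarrow>\<^sub>0 nat) \<Rightarrow>\<^sub>0 real) fract"

definition indet_pole :: "'n::linorder \<Rightarrow> 'n rat_functions" where
  "indet_pole i = to_fract (Poly_Mapping.single (Poly_Mapping.single i 1) 1)"

definition const_pole :: "real \<Rightarrow> 'n::linorder rat_functions" where
  "const_pole c = to_fract (Poly_Mapping.single 0 c)"

section \<open>General 2-paths\<close>

definition general_2path ::
    "('v, 'b) pre_digraph \<Rightarrow> (2 \<Rightarrow> 'v) \<Rightarrow> (2 \<Rightarrow> 'v) \<Rightarrow> (2 \<Rightarrow> 'b list) \<Rightarrow> bool" where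
  "general_2path D inp outp P \<longleftrightarrow>
     (\<exists>j. bij j \<and>
        (\<forall>i. pre_digraph.apath D (inp (j i)) (P i) (outp i)) \<and>
        set (pre_digraph.awalk_verts D (inp (j 1)) (P 1)) \<inter>
        set (pre_digraph.awalk_verts D (inp (j 2)) (P 2)) = {})"

end

theory Submission
  imports Defs
begin

text \<open>
  Write the node equations with polynomial coefficients in \<open>s\<close>, using that the head of \<open>x\<^sub>i\<close> carries
  the state \<open>x\<^sub>i\<close>, so that its equation is \<open>(s - z\<^sub>i) \<xi>\<^sub>v = \<xi>\<^sub>w\<close> with \<open>w\<close> the tail of \<open>x\<^sub>i\<close>.  If \<open>T\<close> is
  invertible, then a solution that vanishes at the outputs has zero input and hence vanishes.  So the
  square matrix with one row for every non-input node and one column for every non-output node is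
  nonsingular, and therefore has a transversal of nonzero entries, that is, a bijection \<open>\<sigma>\<close> such that
  every non-input node \<open>v\<close> satisfies \<open>\<sigma> v = v\<close> or is the head of a branch that starts at \<open>\<sigma> v\<close>.
  Iterating \<open>\<sigma>\<close> from an output traces a path backwards to an input, and by injectivity of \<open>\<sigma>\<close> the
  two paths are disjoint.
\<close>

section \<open>Transversals of nonsingular matrices\<close>

text \<open>Gaussian elimination by induction on the rows. Elimination is by cross multiplication
  instead of division, so it works over any integral domain; it is meant for polynomial
  entries.\<close>

lemma underdetermined_system_nontrivial:
  fixes M :: "'r \<Rightarrow> 'c \<Rightarrow> 'a::idom"
  assumes "finite R" "finite S" "card R < card S"
  shows "\<exists>\<xi>. (\<exists>c\<in>S. \<xi> c \<noteq> 0) \<and> (\<forall>r\<in>R. (\<Sum>c\<in>S. M r c * \<xi> c) = 0)"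
  using assms
proof (induction R arbitrary: S M rule: finite_induct)
  case empty
  then have "S \<noteq> {}" by auto
  then show ?case by (intro exI[of _ "\<lambda>_. 1"]) auto
next
  case (insert r R)
  show ?case
  proof (cases "\<forall>c\<in>S. M r c = 0")
    case True
    have "card R < card S" using insert by simp
    then obtain \<xi> where "\<exists>c\<in>S. \<xi> c \<noteq> 0" "\<forall>q\<in>R. (\<Sum>c\<in>S. M q c * \<xi> c) = 0"
      using insert.IH insert.prems(1) by blast
    moreover have "(\<Sum>c\<in>S. M r c * \<xi> c) = 0"
      using True by simp
    ultimately show ?thesis by blast
  next
    case False
    then obtain c0 where c0: "c0 \<in> S" "M r c0 \<noteq> 0" by blast
    let ?S = "S - {c0}"
    have "card R < card ?S" using insert c0 by simp
    then obtain \<eta> where nz: "\<exists>c\<in>?S. \<eta> c \<noteq> 0"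
      and ker: "\<And>q. q \<in> R \<Longrightarrow> (\<Sum>c\<in>?S. (M r c0 * M q c - M q c0 * M r c) * \<eta> c) = 0"
      using insert.IH[of ?S "\<lambda>q c. M r c0 * M q c - M q c0 * M r c"] insert.prems by auto
    \<comment> \<open>Back substitution scaled by the pivot \<open>M r c0\<close>: the value at
      \<open>c0\<close> cancels row \<open>r\<close>, and every other row turns into its eliminated
      form applied to \<open>\<eta>\<close>.\<close>
    define \<xi> where "\<xi> c = (if c = c0 then - (\<Sum>c\<in>?S. M r c * \<eta> c) else M r c0 * \<eta> c)" for c
    have row: "(\<Sum>c\<in>S. M q c * \<xi> c) = (\<Sum>c\<in>?S. (M r c0 * M q c - M q c0 * M r c) * \<eta> c)" for q
    proof -
      have "(\<Sum>c\<in>S. M q c * \<xi> c) = M q c0 * \<xi> c0 + (\<Sum>c\<in>?S. M q c * \<xi> c)"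
        using c0 insert.prems by (simp add: sum.remove)
      also have "(\<Sum>c\<in>?S. M q c * \<xi> c) = (\<Sum>c\<in>?S. M q c * (M r c0 * \<eta> c))"
        by (rule sum.cong) (auto simp: \<xi>_def)
      finally show ?thesis
        by (simp add: \<xi>_def sum_distrib_left sum_subtractf algebra_simps)
    qed
    have "(\<Sum>c\<in>S. M q c * \<xi> c) = 0" if "q \<in> insert r R" for q
      using that ker row by (auto simp: algebra_simps)
    moreover have "\<exists>c\<in>S. \<xi> c \<noteq> 0"
      using nz c0 by (auto simp: \<xi>_def)
    ultimately show ?thesis by blast
  qed
qed

text \<open>Plays the role of a nonzero term in the Leibniz expansion of the determinant. Rows and
  columns are indexed by different sets, so nonsingularity is expressed as a trivial kernel, and one
  row and one column are removed at a time.\<close>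

lemma nonsingular_imp_transversal:
  fixes M :: "'r \<Rightarrow> 'c \<Rightarrow> 'a::idom"
  assumes "finite R" "finite S" "card R = card S"
    and "\<And>\<xi>. (\<And>r. r \<in> R \<Longrightarrow> (\<Sum>c\<in>S. M r c * \<xi> c) = 0) \<Longrightarrow> \<forall>c\<in>S. \<xi> c = 0"
  shows "\<exists>\<sigma>. bij_betw \<sigma> R S \<and> (\<forall>r\<in>R. M r (\<sigma> r) \<noteq> 0)"
  using assms
proof (induction R arbitrary: S rule: finite_induct)
  case empty
  then have "S = {}" by simp
  then show ?case by (simp add: bij_betw_def)
next
  case (insert r R)
  let ?row = "\<lambda>q \<xi>. \<Sum>c\<in>S. M q c * \<xi> c"
  have "card R < card S" using insert by simp
  then obtain \<xi> where \<xi>: "\<exists>c\<in>S. \<xi> c \<noteq> 0" "\<And>q. q \<in> R \<Longrightarrow> ?row q \<xi> = 0"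
    using underdetermined_system_nontrivial[of R S M] insert by blast
  \<comment> \<open>Otherwise \<open>\<xi>\<close> would be a nonzero kernel vector of the whole
    matrix. A nonzero summand yields a column \<open>c\<close> with \<open>M r c \<noteq> 0\<close>,
    the new transversal entry, and \<open>\<xi> c \<noteq> 0\<close>, which is needed for the
    minor.\<close>
  have "?row r \<xi> \<noteq> 0"
    using \<xi> insert.prems(3)[of \<xi>] by auto
  then obtain c where c: "c \<in> S" "M r c * \<xi> c \<noteq> 0"
    by (meson sum.neutral)
  \<comment> \<open>The rows \<open>R\<close> have the one-dimensional kernel spanned by \<open>\<xi>\<close>, and \<open>\<xi> c \<noteq> 0\<close>, so the minor
    without row \<open>r\<close> and column \<open>c\<close> is again nonsingular.\<close>
  have minor: "\<forall>c'\<in>S - {c}. \<eta> c' = 0"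
    if \<eta>: "\<And>q. q \<in> R \<Longrightarrow> (\<Sum>c'\<in>S - {c}. M q c' * \<eta> c') = 0" for \<eta>
  proof -
    let ?\<eta> = "\<eta>(c := 0)"
    have "?row q ?\<eta> = (\<Sum>c'\<in>S - {c}. M q c' * \<eta> c')" for q
      using c insert.prems by (simp add: sum.remove)
    with \<eta> have ker: "?row q ?\<eta> = 0" if "q \<in> R" for q
      using that by simp
    \<comment> \<open>The combination \<open>a * \<xi> - b * ?\<eta>\<close> is killed by row
      \<open>r\<close> as well, hence vanishes on \<open>S\<close>. At \<open>c\<close>, where
      \<open>?\<eta>\<close> is 0, this reads \<open>a * \<xi> c = 0\<close>, so
      \<open>a = 0\<close>.\<close>
    define a b where "a = ?row r ?\<eta>" and "b = ?row r \<xi>"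
    have row: "?row q (\<lambda>d. a * \<xi> d - b * ?\<eta> d) = a * ?row q \<xi> - b * ?row q ?\<eta>" for q
      by (simp only: right_diff_distrib sum_subtractf sum_distrib_left mult.left_commute)
    have "?row q (\<lambda>d. a * \<xi> d - b * ?\<eta> d) = 0" if "q \<in> insert r R" for q
    proof (cases "q = r")
      case True
      then show ?thesis
        by (simp only: row True a_def[symmetric] b_def[symmetric]) (simp add: mult.commute)
    next
      case False
      then show ?thesis
        unfolding row using that ker \<xi>(2) by simp
    qed
    then have "\<forall>d\<in>S. a * \<xi> d - b * ?\<eta> d = 0"
      by (intro insert.prems(3))
    then have "a * \<xi> c - b * ?\<eta> c = 0" using c(1) by blast
    then have "?row r ?\<eta> = 0" using c(2) by (simp add: a_def)
    with ker have "\<forall>d\<in>S. ?\<eta> d = 0"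
      using \<open>?row r ?\<eta> = 0\<close> by (intro insert.prems(3)) blast
    then show ?thesis by (metis Diff_iff fun_upd_other insertI1)
  qed
  have "card R = card (S - {c})" using insert c by simp
  with insert.IH[of "S - {c}"] insert.prems minor
  obtain \<sigma> where \<sigma>: "bij_betw \<sigma> R (S - {c})" "\<forall>q\<in>R. M q (\<sigma> q) \<noteq> 0"
    by blast
  have "bij_betw (\<sigma>(r := c)) R (S - {c})"
    using \<sigma>(1) insert.hyps by (metis bij_betw_cong fun_upd_other)
  then have "bij_betw (\<sigma>(r := c)) (R \<union> {r}) ((S - {c}) \<union> {(\<sigma>(r := c)) r})"
    using insert.hyps by (intro notIn_Un_bij_betw) simp_all
  then have "bij_betw (\<sigma>(r := c)) (insert r R) S"
    using c by (simp add: insert_absorb)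
  moreover have "\<forall>q\<in>insert r R. M q ((\<sigma>(r := c)) q) \<noteq> 0"
    using \<sigma>(2) c(2) by auto
  ultimately show ?case by blast
qed

section \<open>The resolvent\<close>

lemma rat_const_mult_to_fract: "rat_const a * to_fract p = to_fract (smult a p)"
  by (simp add: rat_const_def flip: to_fract_mult)

text \<open>The variable \<open>s\<close> is not an eigenvalue of a constant matrix: comparing
  coefficients of \<open>s^(m+1)\<close> expresses the coefficients at \<open>m\<close> through
  those at \<open>m + 1\<close>, and beyond the largest degree all are 0, so descending induction
  applies.\<close>

lemma eigenvector_of_indeterminate:
  fixes A :: "'k::field ^ 'n ^ 'n" and p :: "'n \<Rightarrow> 'k poly"
  assumes "\<And>i. pCons 0 (p i) = (\<Sum>j\<in>UNIV. smult (A $ i $ j) (p j))"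
  shows "p i = 0"
proof -
  define N where "N = Suc (Max (range (\<lambda>i. degree (p i))))"
  have rec: "coeff (p i) m = (\<Sum>j\<in>UNIV. A $ i $ j * coeff (p j) (Suc m))" for i m
    using arg_cong[OF assms[of i], of "\<lambda>q. coeff q (Suc m)"] by (simp add: coeff_sum)
  have big: "coeff (p i) m = 0" if "m \<ge> N" for i m
  proof (rule coeff_eq_0)
    have "degree (p i) \<le> Max (range (\<lambda>i. degree (p i)))" by (rule Max_ge) auto
    then show "degree (p i) < m" using that unfolding N_def by linarith
  qed
  have "\<forall>i. coeff (p i) m = 0" for m
  proof (cases "m \<ge> N")
    case False
    then have "m \<le> N" by simp
    then show ?thesis
    proof (induction rule: inc_induct)
      case (step m)
      then show ?case by (subst rec) simp
    qed (use big in blast)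
  qed (use big in auto)
  then show ?thesis by (auto intro: poly_eqI)
qed

lemma common_denominator:
  fixes f :: "'i::finite \<Rightarrow> 'a::idom fract"
  obtains q p where "q \<noteq> 0" "\<And>i. to_fract q * f i = to_fract (p i)"
proof -
  have "\<exists>a b. b \<noteq> 0 \<and> f i = Fract a b" for i
    by (cases "f i") auto
  then obtain a b where ab: "\<And>i. b i \<noteq> 0" "\<And>i. f i = Fract (a i) (b i)"
    by metis
  show ?thesis
  proof (rule that)
    show "(\<Prod>i\<in>UNIV. b i) \<noteq> 0" using ab by simp
    show "to_fract (\<Prod>i\<in>UNIV. b i) * f i = to_fract (a i * (\<Prod>j\<in>UNIV - {i}. b j))" for i
      using ab by (simp add: prod.remove[of UNIV i] to_fract_def eq_fract)
  qed
qed

text \<open>A kernel vector, cleared of denominators, is a polynomial vector \<open>p\<close> with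
  \<open>s p = A p\<close>, hence zero.\<close>

lemma invertible_char_matrix:
  fixes A :: "'k::field ^ 'n ^ 'n"
  shows "invertible (mat (to_fract [:0, 1:]) - map_matrix rat_const A)"
proof -
  have "f = 0" if f: "(mat (to_fract [:0, 1:]) - map_matrix rat_const A) *v f = 0" for f
  proof -
    obtain q p where qp: "q \<noteq> 0" "\<And>i. to_fract q * f $ i = to_fract (p i)"
      using common_denominator[of "\<lambda>i. f $ i"] by blast
    have "pCons 0 (p i) = (\<Sum>j\<in>UNIV. smult (A $ i $ j) (p j))" for i
    proof -
      have "to_fract [:0, 1:] * f $ i = (\<Sum>j\<in>UNIV. rat_const (A $ i $ j) * f $ j)"
        using arg_cong[OF f, of "\<lambda>v. v $ i"]
        by (simp add: matrix_vector_mult_def mat_def left_diff_distrib sum_subtractf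
            if_distrib[of "\<lambda>a. a * _"] cong: if_cong)
      then have "to_fract q * (to_fract [:0, 1:] * f $ i)
          = to_fract q * (\<Sum>j\<in>UNIV. rat_const (A $ i $ j) * f $ j)"
        by simp
      then have "to_fract [:0, 1:] * to_fract (p i)
          = (\<Sum>j\<in>UNIV. rat_const (A $ i $ j) * to_fract (p j))"
        by (simp add: sum_distrib_left mult.left_commute flip: qp(2))
      then have "to_fract ([:0, 1:] * p i) = to_fract (\<Sum>j\<in>UNIV. smult (A $ i $ j) (p j))"
        by (simp only: rat_const_mult_to_fract to_fract_mult to_fract_sum)
      then have "[:0, 1:] * p i = (\<Sum>j\<in>UNIV. smult (A $ i $ j) (p j))"
        by (simp only: to_fract_eq_iff)
      then show ?thesis by simp
    qed
    then have "p i = 0" for i by (rule eigenvector_of_indeterminate)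
    then show ?thesis using qp by (simp add: vec_eq_iff)
  qed
  then show ?thesis
    by (simp add: invertible_left_inverse matrix_left_invertible_ker)
qed

text \<open>Links the state equations to \<open>T\<close>: the hypothesis is
  \<open>(sI - A) X = B U\<close>, which is solved for \<open>X\<close> by the resolvent.\<close>

lemma transfer_matrix_mult:
  fixes A :: "'k::field ^ 'n ^ 'n"
  assumes "to_fract [:0, 1:] *s X = map_matrix rat_const A *v X + map_matrix rat_const B *v U"
  shows "transfer_matrix A B C *v U = map_matrix rat_const C *v X"
proof -
  let ?M = "mat (to_fract [:0, 1:]) - map_matrix rat_const A"
  have "mat c *v v = c *s v" for c and v :: "'k poly fract ^ 'n"
    by (simp add: vec_eq_iff matrix_vector_mult_def mat_def if_distrib[of "\<lambda>a. a * _"] cong: if_cong)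
  then have "map_matrix rat_const B *v U = ?M *v X"
    using assms by (simp add: matrix_vector_mult_diff_rdistrib)
  then have "transfer_matrix A B C *v U = map_matrix rat_const C *v (matrix_inv ?M ** ?M *v X)"
    by (simp add: transfer_matrix_def flip: matrix_vector_mul_assoc)
  also have "matrix_inv ?M ** ?M = mat 1"
    using someI_ex[OF invertible_char_matrix[of A, unfolded invertible_def]]
    unfolding matrix_inv_def by blast
  finally show ?thesis by simp
qed

section \<open>Disjoint paths from a transversal\<close>

text \<open>The sequence runs against the arcs, as the iterates of \<open>\<sigma>\<close> from an
  output do. The exact node list is recorded so that distinctness and disjointness can be read off
  from \<open>f\<close>.\<close>

lemma (in wf_digraph) awalk_of_sequence:
  assumes "f 0 \<in> verts G"
    and "\<And>m. m < n \<Longrightarrow> \<exists>e\<in>arcs G. tail G e = f (Suc m) \<and> head G e = f m"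
  shows "\<exists>p. awalk (f n) p (f 0) \<and> awalk_verts (f n) p = map f (rev [0..<Suc n])"
  using assms
proof (induction n)
  case 0
  then show ?case by (intro exI[of _ "[]"]) (simp add: awalk_Nil_iff)
next
  case (Suc n)
  then obtain p where p: "awalk (f n) p (f 0)" "awalk_verts (f n) p = map f (rev [0..<Suc n])"
    by fastforce
  obtain e where "e \<in> arcs G" "tail G e = f (Suc n)" "head G e = f n"
    using Suc.prems(2) by blast
  with p show ?case
    by (intro exI[of _ "e # p"]) (simp add: awalk_Cons_iff)
qed

text \<open>Cancel \<open>\<sigma>\<close> on both sides by injectivity until one exponent is 0. If
  the other were still positive, a point of \<open>range dst\<close> would lie in the image of
  \<open>\<sigma>\<close>, which avoids \<open>range dst\<close>. The case \<open>k = l\<close>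
  shows that a single orbit does not repeat a node.\<close>

lemma orbits_disjoint:
  fixes \<sigma> :: "'v \<Rightarrow> 'v" and src dst :: "'i \<Rightarrow> 'v"
  assumes \<sigma>: "bij_betw \<sigma> (V - range src) (V - range dst)"
    and dst: "range dst \<subseteq> V" "inj dst"
    and "(\<sigma> ^^ m) (dst k) = (\<sigma> ^^ n) (dst l)"
    and "\<And>i. i < m \<Longrightarrow> (\<sigma> ^^ i) (dst k) \<notin> range src"
    and "\<And>i. i < n \<Longrightarrow> (\<sigma> ^^ i) (dst l) \<notin> range src"
  shows "k = l \<and> m = n"
proof -
  \<comment> \<open>Before reaching a source the orbit stays in the domain of
    \<open>\<sigma>\<close>, and after the first step it never meets
    \<open>range dst\<close>.\<close>
  have step: "(\<sigma> ^^ i) (dst k) \<in> V - range src \<and> (\<sigma> ^^ Suc i) (dst k) \<in> V - range dst"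
    if "i < m" "\<And>i. i < m \<Longrightarrow> (\<sigma> ^^ i) (dst k) \<notin> range src" for i m k
    using that
  proof (induction i)
    case 0
    then have "dst k \<in> V - range src" using dst(1) 0(2)[of 0] by auto
    then show ?case using bij_betw_apply[OF \<sigma>] by simp
  next
    case (Suc i)
    then have "(\<sigma> ^^ Suc i) (dst k) \<in> V - range src" by (meson DiffD1 DiffI Suc_lessD)
    then show ?case using bij_betw_apply[OF \<sigma>] by simp
  qed
  show ?thesis
    using assms(4-6)
  proof (induction m arbitrary: n)
    case 0
    show ?case
    proof (cases n)
      case (Suc n')
      then have "(\<sigma> ^^ n) (dst l) \<notin> range dst"
        using step[of n' n l] 0 by blast
      then show ?thesis using 0(1) by (metis funpow_0 rangeI)
    qed (use 0 dst(2) in \<open>simp add: inj_eq\<close>)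
  next
    case (Suc m)
    note m = step[of m "Suc m" k, OF lessI Suc.prems(2)]
    show ?case
    proof (cases n)
      case 0
      then show ?thesis using m Suc.prems(1) by (metis DiffD2 funpow_0 rangeI)
    next
      case (Suc n')
      then have "(\<sigma> ^^ n') (dst l) \<in> V - range src"
        using step[of n' n l] Suc.prems(3) by blast
      then have "(\<sigma> ^^ m) (dst k) = (\<sigma> ^^ n') (dst l)"
        using m Suc.prems(1) Suc bij_betw_imp_inj_on[OF \<sigma>]
        by (simp add: inj_on_eq_iff)
      then have "k = l \<and> m = n'"
        using Suc Suc.prems by (intro Suc.IH) auto
      then show ?thesis using Suc by simp
    qed
  qed
qed

text \<open>An orbit avoiding the sources forever would be an injective sequence in the finite set
  \<open>V\<close>.\<close>

lemma orbit_reaches_source: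
  fixes \<sigma> :: "'v \<Rightarrow> 'v" and src dst :: "'i \<Rightarrow> 'v"
  assumes "finite V" and \<sigma>: "bij_betw \<sigma> (V - range src) (V - range dst)"
    and dst: "range dst \<subseteq> V" "inj dst"
  obtains n where "(\<sigma> ^^ n) (dst k) \<in> range src" "\<And>i. i < n \<Longrightarrow> (\<sigma> ^^ i) (dst k) \<notin> range src"
proof -
  let ?f = "\<lambda>n. (\<sigma> ^^ n) (dst k)"
  have "\<exists>n. ?f n \<in> range src"
  proof (rule ccontr)
    assume "\<nexists>n. ?f n \<in> range src"
    then have out: "?f n \<notin> range src" for n by blast
    have "?f n \<in> V" for n
    proof (induction n)
      case (Suc n)
      then have "?f n \<in> V - range src" using out by blast
      then show ?case using bij_betw_apply[OF \<sigma>] by simp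
    qed (use dst(1) in auto)
    moreover have "inj ?f"
      by (rule injI) (use orbits_disjoint[OF \<sigma> dst] out in blast)
    ultimately have "finite (UNIV :: nat set)"
      using \<open>finite V\<close> by (metis finite_imageD finite_subset image_subsetI)
    then show False by simp
  qed
  then show ?thesis
    using that[of "LEAST n. ?f n \<in> range src"] by (metis (mono_tags, lifting) LeastI_ex not_less_Least)
qed

lemma (in wf_digraph) general_2path_of_transversal:
  fixes inp outp :: "2 \<Rightarrow> 'a"
  assumes "finite (verts G)"
    and \<sigma>: "bij_betw \<sigma> (verts G - range inp) (verts G - range outp)"
    and outp: "range outp \<subseteq> verts G" "inj outp"
    and arc: "\<And>v. v \<in> verts G - range inp \<Longrightarrow>
      \<sigma> v = v \<or> (\<exists>e\<in>arcs G. tail G e = \<sigma> v \<and> head G e = v)"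
  shows "\<exists>P. general_2path G inp outp P"
proof -
  let ?f = "\<lambda>k n. (\<sigma> ^^ n) (outp k)"
  have "\<exists>n. ?f k n \<in> range inp \<and> (\<forall>i<n. ?f k i \<notin> range inp)" for k
    using orbit_reaches_source[OF assms(1) \<sigma> outp, of k] by metis
  then obtain N where N: "\<And>k. ?f k (N k) \<in> range inp" "\<And>k i. i < N k \<Longrightarrow> ?f k i \<notin> range inp"
    by metis
  have disj: "k = l \<and> m = n" if "?f k m = ?f l n" "m \<le> N k" "n \<le> N l" for k l m n
    using orbits_disjoint[OF \<sigma> outp that(1)] N(2) that by (meson less_le_trans)
  have "\<exists>j. inp j = ?f k (N k)" for k
    using N(1)[of k] by (metis imageE)
  then obtain j where j: "\<And>k. inp (j k) = ?f k (N k)" by metis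
  \<comment> \<open>Two orbits ending at the same input would share a node, so \<open>j\<close> is
    the permutation required of a general 2-path.\<close>
  have "inj j"
    by (rule injI) (metis disj j order_refl)
  then have "bij j"
    by (simp add: bij_def finite_UNIV_inj_surj)
  have in_V: "?f k n \<in> verts G" if "n \<le> N k" for k n
    using that
  proof (induction n)
    case (Suc n)
    then have "?f k n \<in> verts G - range inp" using N(2) by simp
    then show ?case using bij_betw_apply[OF \<sigma>] by simp
  qed (use outp(1) in auto)
  have "\<exists>p. awalk (?f k (N k)) p (?f k 0) \<and> awalk_verts (?f k (N k)) p = map (?f k) (rev [0..<Suc (N k)])"
    for k
  proof (rule awalk_of_sequence)
    show "?f k 0 \<in> verts G" using in_V[of 0 k] by simp
    show "\<exists>e\<in>arcs G. tail G e = ?f k (Suc m) \<and> head G e = ?f k m" if "m < N k" for m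
    proof -
      have "?f k m \<in> verts G - range inp" using in_V N(2) that by simp
      \<comment> \<open>The fixed-point alternative \<open>\<sigma> v = v\<close> cannot occur along
        an orbit, since its nodes are distinct; hence consecutive nodes are joined by an
        arc.\<close>
      moreover have "?f k (Suc m) \<noteq> ?f k m" using disj[where k=k and l=k and m="Suc m" and n=m] that by auto
      ultimately show ?thesis using arc by fastforce
    qed
  qed
  then obtain P where P: "\<And>k. awalk (inp (j k)) (P k) (outp k)"
    "\<And>k. awalk_verts (inp (j k)) (P k) = map (?f k) (rev [0..<Suc (N k)])"
    unfolding j by (metis funpow_0)
  have "apath (inp (j k)) (P k) (outp k)" for k
  proof -
    have "inj_on (?f k) {0..<Suc (N k)}"
      by (rule inj_onI) (use disj in auto)
    then show ?thesis
      using P by (simp add: apath_def distinct_map del: upt_Suc)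
  qed
  moreover have "set (awalk_verts (inp (j 1)) (P 1)) \<inter> set (awalk_verts (inp (j 2)) (P 2)) = {}"
    unfolding P(2) using disj[where k=1 and l=2] by (auto simp: less_Suc_eq_le simp del: upt_Suc)
  ultimately show ?thesis
    unfolding general_2path_def using \<open>bij j\<close> by blast
qed

section \<open>The node matrix\<close>

lemma rat_const_matrix_vector:
  fixes A :: "'k::field ^ 'm ^ 'n"
  shows "map_matrix rat_const A *v (\<chi> j. to_fract (p j))
    = (\<chi> i. to_fract (\<Sum>j\<in>UNIV. smult (A $ i $ j) (p j)))"
  by (simp add: vec_eq_iff matrix_vector_mult_def rat_const_mult_to_fract)

context tito_sfg
begin

lemma head_first_order_inj: "inj (\<lambda>i. head D (x i))"
  using first_order_series(1) first_order_inj by (metis (no_types, lifting) injI inj_eq singleton_inject)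

lemma in_arcs_inp: "in_arcs D (inp k) = {}"
  using inp_in_degree[of k] by (simp add: in_degree_def card_eq_0_iff finite_in_arcs)

text \<open>The factor of \<open>\<xi> v\<close> in the node equation with polynomial coefficients:
  \<open>s - z i\<close> at the head of \<open>x i\<close>, as in the Laplace transform of the state
  equation with zero initial state, and 1 elsewhere.\<close>

definition node_coeff :: "('n \<Rightarrow> 'k::field) \<Rightarrow> 'v \<Rightarrow> 'k poly" where
  "node_coeff z v =
    (if v \<in> range (\<lambda>i. head D (x i)) then [:- z (inv (\<lambda>i. head D (x i)) v), 1:] else 1)"

lemma node_coeff_first_order: "node_coeff z (head D (x i)) = [:- z i, 1:]"
  by (simp add: node_coeff_def inv_f_f[OF head_first_order_inj])

lemma node_coeff_zero_order: "v \<notin> range (\<lambda>i. head D (x i)) \<Longrightarrow> node_coeff z v = 1"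
  by (simp add: node_coeff_def)

text \<open>The linear system is given over \<open>'k\<close> only; it is transferred to polynomial node variables
  coefficientwise.\<close>

lemma node_equations_coeff:
  fixes \<xi> :: "'v \<Rightarrow> 'k::field poly"
  assumes "\<And>v. v \<in> verts D - range inp \<Longrightarrow>
      node_coeff z v * \<xi> v = (\<Sum>e\<in>in_arcs D v. \<xi> (tail D e))"
  shows "node_equations D x inp (\<chi> i. coeff (\<xi> (head D (x i))) m) (\<chi> k. coeff (\<xi> (inp k)) m)
    (\<lambda>v. coeff (\<xi> v) m)"
  unfolding node_equations_def
proof (intro conjI allI ballI)
  fix v assume v: "v \<in> verts D - range inp"
  let ?X = "\<chi> i. coeff (\<xi> (head D (x i))) m"
  show "coeff (\<xi> v) m = (\<Sum>i | x i \<in> in_arcs D v. ?X $ i) +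
      (\<Sum>e\<in>in_arcs D v - range x. coeff (\<xi> (tail D e)) m)"
  \<comment> \<open>At the head of \<open>x i\<close> the equation is an identity, because the state
    is read off there; at other nodes the factor is 1, so coefficients can be compared
    directly.\<close>
  proof (cases "v \<in> range (\<lambda>i. head D (x i))")
    case True
    then obtain i where i: "v = head D (x i)" by blast
    have states: "{j. x j \<in> in_arcs D v} = {i}"
      using i first_order_series(1)[of i] first_order_inj by (auto simp: inj_eq)
    have "in_arcs D v - range x = {}"
      using i first_order_series(1)[of i] by simp
    then show ?thesis unfolding states
      by (simp only: sum.empty sum.insert finite.emptyI) (simp add: i)
  next
    case False
    have no_states: "{i. x i \<in> in_arcs D v} = {}" "in_arcs D v - range x = in_arcs D v"
      using False by auto
    have "coeff (\<xi> v) m = (\<Sum>e\<in>in_arcs D v. coeff (\<xi> (tail D e)) m)"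
      using assms[OF v] node_coeff_zero_order[OF False, of z] by (simp add: coeff_sum)
    then show ?thesis unfolding no_states by simp
  qed
qed simp

text \<open>Zero output gives \<open>T U = 0\<close>, so \<open>U = 0\<close> by invertibility; then
  \<open>s X = A X\<close> forces \<open>X = 0\<close>, and unique solvability of the node equations
  with zero state and input makes every node variable vanish.\<close>

lemma zero_output_imp_zero:
  fixes \<xi> :: "'v \<Rightarrow> 'k::field poly"
  assumes sys: "linear_system D x inp outp z A B C"
    and inv: "invertible (transfer_matrix A B C)"
    and eqs: "\<And>v. v \<in> verts D - range inp \<Longrightarrow>
      node_coeff z v * \<xi> v = (\<Sum>e\<in>in_arcs D v. \<xi> (tail D e))"
    and out: "\<And>k. \<xi> (outp k) = 0"
    and v: "v \<in> verts D"
  shows "\<xi> v = 0"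
proof -
  define X U where "X i = \<xi> (head D (x i))" and "U k = \<xi> (inp k)" for i k
  have node: "node_equations D x inp (\<chi> i. coeff (X i) m) (\<chi> k. coeff (U k) m) (\<lambda>v. coeff (\<xi> v) m)" for m
    unfolding X_def U_def by (rule node_equations_coeff) (rule eqs)
  have system: "z i * X' $ i + \<eta> (tail D (x i)) = (A *v X' + B *v U') $ i"
      "\<eta> (outp k) = (C *v X') $ k"
    if "node_equations D x inp X' U' \<eta>" for X' U' \<eta> i k
    using sys[unfolded linear_system_def, THEN conjunct2, THEN conjunct1,
        THEN spec, THEN spec, THEN spec, THEN mp, OF that] by blast+
  have state: "z i * coeff (X i) m + coeff (\<xi> (tail D (x i))) m
      = (\<Sum>j\<in>UNIV. A $ i $ j * coeff (X j) m) + (\<Sum>k\<in>UNIV. B $ i $ k * coeff (U k) m)" for i m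
    using system(1)[OF node[of m], of i] by (simp add: matrix_vector_mult_def)
  have "(\<Sum>i\<in>UNIV. C $ k $ i * coeff (X i) m) = 0" for k m
    using system(2)[OF node[of m], of k] by (simp add: matrix_vector_mult_def out)
  then have CX: "(\<Sum>i\<in>UNIV. smult (C $ k $ i) (X i)) = 0" for k
    by (intro poly_eqI) (simp add: coeff_sum)
  \<comment> \<open>The node equation at the head of \<open>x i\<close> reads
    \<open>s X i = z i X i + \<xi> (tail D (x i))\<close>; \<open>state\<close> rewrites its
    right-hand side through \<open>A\<close> and \<open>B\<close>.\<close>
  have dyn: "pCons 0 (X i) = (\<Sum>j\<in>UNIV. smult (A $ i $ j) (X j)) + (\<Sum>k\<in>UNIV. smult (B $ i $ k) (U k))"
    for i
  proof -
    have "head D (x i) \<in> verts D - range inp"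
    proof -
      have "in_arcs D (head D (x i)) \<noteq> {}" using first_order_series(1)[of i] by simp
      moreover have "x i \<in> arcs D" using first_order_arcs by blast
      ultimately show ?thesis using in_arcs_inp by auto
    qed
    from eqs[OF this] have "pCons 0 (X i) = smult (z i) (X i) + \<xi> (tail D (x i))"
      by (simp add: node_coeff_first_order first_order_series(1) X_def algebra_simps)
    then show ?thesis
      by (intro poly_eqI) (simp add: state coeff_sum)
  qed
  let ?X = "\<chi> i. to_fract (X i)" and ?U = "\<chi> k. to_fract (U k)"
  have "to_fract [:0, 1:] *s ?X = map_matrix rat_const A *v ?X + map_matrix rat_const B *v ?U"
    unfolding rat_const_matrix_vector
    by (simp add: vec_eq_iff dyn flip: to_fract_mult to_fract_add to_fract_sum)
  then have "transfer_matrix A B C *v ?U = map_matrix rat_const C *v ?X"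
    by (rule transfer_matrix_mult)
  also have "\<dots> = 0"
    unfolding rat_const_matrix_vector CX by (simp add: vec_eq_iff)
  finally have "?U = 0"
    using inv by (metis invertible_left_inverse matrix_left_invertible_ker)
  then have U: "U k = 0" for k by (simp add: vec_eq_iff)
  then have X: "X i = 0" for i
    using dyn by (intro eigenvector_of_indeterminate[of X A]) simp
  have "coeff (\<xi> v) m = 0" for m
  proof -
    \<comment> \<open>Uniqueness holds only among extensional solutions, so the coefficient function
      and the zero solution are both set to \<open>undefined\<close> off the nodes before being
      compared.\<close>
    let ?\<xi> = "\<lambda>v. if v \<in> verts D then coeff (\<xi> v) m else undefined"
    let ?\<zeta> = "\<lambda>v. if v \<in> verts D then 0 else undefined :: 'k"
    have tail_in: "tail D e \<in> verts D" if "e \<in> in_arcs D w" for e w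
      using that by auto
    have restrict: "node_equations D x inp X' U' (\<lambda>v. if v \<in> verts D then \<eta> v else undefined)"
      if "node_equations D x inp X' U' \<eta>" for X' U' and \<eta> :: "'v \<Rightarrow> 'k"
      using that unfolding node_equations_def
      by (auto simp: inp_verts tail_in intro!: sum.cong)
    have "node_equations D x inp (0 :: 'k ^ 'n) 0 (\<lambda>v. coeff (\<xi> v) m)"
      using node[of m] by (simp add: U X flip: zero_vec_def)
    then have "node_equations D x inp 0 0 ?\<xi>" by (rule restrict)
    moreover have "node_equations D x inp 0 0 ?\<zeta>"
      by (rule restrict) (simp add: node_equations_def)
    moreover have "\<exists>!\<xi>. \<xi> \<in> extensional (verts D) \<and> node_equations D x inp (0 :: 'k ^ 'n) 0 \<xi>"
      by (rule sys[unfolded linear_system_def, THEN conjunct1, THEN spec, THEN spec])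
    moreover have "?\<xi> \<in> extensional (verts D)" "?\<zeta> \<in> extensional (verts D)"
      by (auto simp: extensional_def)
    ultimately have "?\<xi> = ?\<zeta>" by blast
    then show ?thesis using v by (metis (full_types))
  qed
  then show ?thesis by (intro poly_eqI) simp
qed

text \<open>Formulated over an arbitrary field \<open>'k\<close>, so that indeterminate and real
  poles are both instances.\<close>

lemma general_2path_of_invertible:
  fixes z :: "'n \<Rightarrow> 'k::field"
  assumes sys: "linear_system D x inp outp z A B C"
    and inv: "invertible (transfer_matrix A B C)"
  shows "\<exists>P. general_2path D inp outp P"
proof -
  let ?R = "verts D - range inp" and ?S = "verts D - range outp"
  \<comment> \<open>Row \<open>v\<close> is the node equation of \<open>v\<close> with all terms on
    one side, so an off-diagonal entry is nonzero only where an arc leads from \<open>w\<close> to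
    \<open>v\<close>.\<close>
  define M :: "'v \<Rightarrow> 'v \<Rightarrow> 'k poly" where
    "M v w = node_coeff z v * of_bool (w = v) - (\<Sum>e\<in>in_arcs D v. of_bool (w = tail D e))" for v w
  have "card ?R = card ?S"
    using inp_verts outp_verts inp_inj outp_inj
    by (simp add: card_Diff_subset card_image image_subset_iff)
  moreover have "\<forall>w\<in>?S. \<xi> w = 0" if ker: "\<And>v. v \<in> ?R \<Longrightarrow> (\<Sum>w\<in>?S. M v w * \<xi> w) = 0" for \<xi>
  proof -
    \<comment> \<open>Omitting the output columns amounts to extending \<open>\<xi>\<close> by 0 at
      the outputs.\<close>
    define \<eta> where "\<eta> w = (if w \<in> ?S then \<xi> w else 0)" for w
    have row: "(\<Sum>w\<in>?S. M v w * \<xi> w) = node_coeff z v * \<eta> v - (\<Sum>e\<in>in_arcs D v. \<eta> (tail D e))"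
      if "v \<in> verts D" for v
    proof -
      have pick: "(\<Sum>w\<in>verts D. of_bool (w = u) * \<eta> w) = \<eta> u" if "u \<in> verts D" for u
        using that by (subst sum.remove[of _ u]) (auto intro!: sum.neutral)
      have "(\<Sum>w\<in>?S. M v w * \<xi> w) = (\<Sum>w\<in>verts D. M v w * \<eta> w)"
        by (intro sum.mono_neutral_cong_left) (auto simp: \<eta>_def)
      also have "\<dots> = node_coeff z v * (\<Sum>w\<in>verts D. of_bool (w = v) * \<eta> w)
          - (\<Sum>e\<in>in_arcs D v. \<Sum>w\<in>verts D. of_bool (w = tail D e) * \<eta> w)"
        unfolding M_def left_diff_distrib sum_subtractf sum_distrib_right mult.assoc sum_distrib_left
        by (subst (2) sum.swap) simp
      also have "(\<Sum>e\<in>in_arcs D v. \<Sum>w\<in>verts D. of_bool (w = tail D e) * \<eta> w)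
          = (\<Sum>e\<in>in_arcs D v. \<eta> (tail D e))"
        by (rule sum.cong[OF refl], rule pick) auto
      finally show ?thesis using pick[OF that] by simp
    qed
    have "\<eta> w = 0" if "w \<in> verts D" for w
    proof (rule zero_output_imp_zero[OF sys inv _ _ that])
      show "node_coeff z v * \<eta> v = (\<Sum>e\<in>in_arcs D v. \<eta> (tail D e))"
        if "v \<in> verts D - range inp" for v
        using row[of v] ker[OF that] that by simp
    qed (simp add: \<eta>_def)
    then show ?thesis by (metis DiffD1 \<eta>_def)
  qed
  ultimately obtain \<sigma> where \<sigma>: "bij_betw \<sigma> ?R ?S" "\<forall>v\<in>?R. M v (\<sigma> v) \<noteq> 0"
    using nonsingular_imp_transversal[of ?R ?S M] by auto
  have "\<sigma> v = v \<or> (\<exists>e\<in>arcs D. tail D e = \<sigma> v \<and> head D e = v)" if "v \<in> ?R" for v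
  proof (rule ccontr)
    assume no: "\<not> ?thesis"
    then have "(\<Sum>e\<in>in_arcs D v. of_bool (\<sigma> v = tail D e)) = (0 :: 'k poly)"
      by (intro sum.neutral) auto
    with no have "M v (\<sigma> v) = 0" by (simp add: M_def)
    with \<sigma>(2) that show False by blast
  qed
  then show ?thesis
    using \<sigma>(1) outp_verts outp_inj by (intro general_2path_of_transversal) auto
qed

end

theorem theorem3p1:
  fixes D :: "('v, 'b) pre_digraph"
    and x :: "'n::{finite, linorder} \<Rightarrow> 'b"
    and inp outp :: "2 \<Rightarrow> 'v"
  assumes "tito_sfg D x inp outp"
  shows "(\<forall>(z :: 'n \<Rightarrow> 'n rat_functions) A B C.
            (\<forall>i. z i = indet_pole i \<or> (\<exists>c. z i = const_pole c)) \<longrightarrow>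
            linear_system D x inp outp z A B C \<longrightarrow>
            invertible (transfer_matrix A B C) \<longrightarrow>
            (\<exists>P. general_2path D inp outp P)) \<and>
         (\<forall>(z :: 'n \<Rightarrow> real) A B C.
            linear_system D x inp outp z A B C \<longrightarrow>
            invertible (transfer_matrix A B C) \<longrightarrow>
            (\<exists>P. general_2path D inp outp P))"
  by (intro conjI allI impI; rule tito_sfg.general_2path_of_invertible[OF assms]; assumption)

end
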